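(* Let $\boldsymbol{\theta}=(\mu,\sigma,\alpha)$ with $\mu\in\mathbb{R}$, $\sigma>0$, $\alpha\in\mathbb{R}$, and let $f(\cdot;\boldsymbol{\theta})$ be the PDF of the BN$(\boldsymbol{\theta})$ distribution. Then $f(\cdot;\boldsymbol{\theta})$ is unimodal when $|\alpha|\leq 1$ and is bimodal when $|\alpha|>1$.
   Context: For $\boldsymbol{\theta}=(\mu,\sigma,\alpha)$, $\mu\in\mathbb{R}$, $\sigma>0$, $\alpha\in\mathbb{R}$, the (uni- or bimodal) normal distribution BN$(\boldsymbol{\theta})$ is the distribution on $\mathbb{R}$ with PDF $$f(x;\boldsymbol{\theta})=\frac{1}{\sqrt{2\pi\sigma^2}}\exp\left[-\frac12\left(\frac{x-\mu}{\sigma}\right)^2-\frac{\alpha^2}{2}\right]\cosh\left[\alpha\left(\frac{x-\mu}{\sigma}\right)\right],\quad x\in\mathbb{R}.$$ Modes are points of local maximum of the density; unimodal (bimodal) means having exactly one (exactly two) modes. *)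

theory Defs
  imports Complex_Main
begin

definition bn_density :: "real \<Rightarrow> real \<Rightarrow> real \<Rightarrow> real \<Rightarrow> real" where
  "bn_density \<mu> \<sigma> \<alpha> x =
     1 / sqrt (2 * pi * \<sigma>\<^sup>2) * exp (- (1 / 2) * ((x - \<mu>) / \<sigma>)\<^sup>2 - \<alpha>\<^sup>2 / 2)
       * cosh (\<alpha> * ((x - \<mu>) / \<sigma>))"

text \<open>Local maxima are meant in the weak (non-strict) sense.\<close>

definition is_mode :: "(real \<Rightarrow> real) \<Rightarrow> real \<Rightarrow> bool" where
  "is_mode f x \<longleftrightarrow> (\<forall>\<^sub>F y in nhds x. f y \<le> f x)"

text \<open>Since infinite sets have cardinality \<open>0\<close>, the two equations below also say
  that the set of modes is finite.\<close>

definition unimodal :: "(real \<Rightarrow> real) \<Rightarrow> bool" where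
  "unimodal f \<longleftrightarrow> card {x. is_mode f x} = 1"

definition bimodal :: "(real \<Rightarrow> real) \<Rightarrow> bool" where
  "bimodal f \<longleftrightarrow> card {x. is_mode f x} = 2"

end

theory Submission
  imports Defs
begin

text \<open>After standardization and removal of constants the density is
  \<open>g z = exp (- z\<^sup>2 / 2) * cosh (\<alpha> * z)\<close>, whose logarithmic derivative is
  \<open>\<alpha> * tanh (\<alpha> * z) - z\<close>. Since \<open>tanh\<close> is strictly concave on the nonnegative reals and has slope
  \<open>1\<close> at the origin, this expression is negative for all \<open>z > 0\<close> if \<open>\<bar>\<alpha>\<bar> \<le> 1\<close>; if
  \<open>\<bar>\<alpha>\<bar> > 1\<close>, it changes sign on the positive axis exactly once, from positive to negative.
  As \<open>g\<close> is even, this determines all its local maxima.\<close>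

section \<open>Concavity of the hyperbolic tangent on the positive axis\<close>

lemma tanh_mvt:
  fixes x y :: real
  assumes "x < y"
  shows "\<exists>\<xi>. x < \<xi> \<and> \<xi> < y \<and> tanh y - tanh x = (y - x) * (1 - (tanh \<xi>)\<^sup>2)"
  by (rule MVT2[OF assms]) (auto intro!: derivative_eq_intros)

lemma tanh_less_self:
  fixes x :: real
  assumes "0 < x"
  shows "tanh x < x"
proof -
  obtain \<xi> where "0 < \<xi>" "tanh x = x * (1 - (tanh \<xi>)\<^sup>2)"
    using tanh_mvt[OF assms] by auto
  moreover from \<open>0 < \<xi>\<close> have "0 < x * (tanh \<xi>)\<^sup>2" using assms by simp
  ultimately show ?thesis by (simp add: right_diff_distrib)
qed

text \<open>Strict concavity in division-free form: the slope \<open>tanh x / x\<close> of the chord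
  from the origin decreases. The mean value points of the chords over \<open>0..x\<close> and
  \<open>x..y\<close> are separated by \<open>x\<close>, and the derivative
  \<open>1 - tanh\<^sup>2\<close> is smaller at the right one.\<close>

lemma tanh_chord_slope_less:
  fixes x y :: real
  assumes "0 < x" "x < y"
  shows "x * tanh y < y * tanh x"
proof -
  obtain \<xi> where \<xi>: "0 < \<xi>" "\<xi> < x" "tanh x = x * (1 - (tanh \<xi>)\<^sup>2)"
    using tanh_mvt[OF assms(1)] by auto
  obtain \<eta> where \<eta>: "x < \<eta>" "tanh y - tanh x = (y - x) * (1 - (tanh \<eta>)\<^sup>2)"
    using tanh_mvt[OF assms(2)] by auto
  have "(tanh \<xi>)\<^sup>2 < (tanh \<eta>)\<^sup>2"
    using \<xi> \<eta> by (intro power_strict_mono) auto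
  then have "x * (y - x) * (1 - (tanh \<eta>)\<^sup>2) < x * (y - x) * (1 - (tanh \<xi>)\<^sup>2)"
    using assms by (intro mult_strict_left_mono) auto
  moreover have "x * (tanh y - tanh x) = x * (y - x) * (1 - (tanh \<eta>)\<^sup>2)"
    by (simp add: \<eta>(2))
  moreover have "(y - x) * tanh x = x * (y - x) * (1 - (tanh \<xi>)\<^sup>2)"
    by (subst \<xi>(3)) simp
  ultimately have "x * (tanh y - tanh x) < (y - x) * tanh x"
    by (simp only:)
  then show ?thesis by (simp add: algebra_simps)
qed

section \<open>The standardized density and its logarithmic derivative\<close>

definition std_bn :: "real \<Rightarrow> real \<Rightarrow> real" where
  "std_bn \<alpha> z = exp (- z\<^sup>2 / 2) * cosh (\<alpha> * z)"

definition log_slope :: "real \<Rightarrow> real \<Rightarrow> real" where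
  "log_slope \<alpha> z = \<alpha> * tanh (\<alpha> * z) - z"

lemma std_bn_pos: "0 < std_bn \<alpha> z"
  by (simp add: std_bn_def)

lemma std_bn_minus [simp]: "std_bn \<alpha> (- z) = std_bn \<alpha> z"
  by (simp add: std_bn_def)

lemma log_slope_minus [simp]: "log_slope \<alpha> (- z) = - log_slope \<alpha> z"
  by (simp add: log_slope_def)

text \<open>Evenness of \<open>cosh\<close> reduces everything to a nonnegative parameter.\<close>

lemma std_bn_abs: "std_bn \<bar>\<alpha>\<bar> z = std_bn \<alpha> z"
  by (simp add: std_bn_def abs_if)

lemma has_field_derivative_std_bn:
  "(std_bn \<alpha> has_field_derivative std_bn \<alpha> z * log_slope \<alpha> z) (at z)"
  unfolding std_bn_def [abs_def] log_slope_def
  by (auto intro!: derivative_eq_intros simp: tanh_def field_simps)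

lemma continuous_on_std_bn: "continuous_on A (std_bn \<alpha>)"
  unfolding std_bn_def [abs_def] by (intro continuous_intros) auto

text \<open>The sign is required only on the open interval, so that the endpoints may be critical
  points; this is how 0 and the positive root \<open>c\<close> occur later.\<close>

lemma std_bn_strict_mono_on:
  assumes "x < y" "\<And>z. x < z \<Longrightarrow> z < y \<Longrightarrow> 0 < log_slope \<alpha> z"
  shows "std_bn \<alpha> x < std_bn \<alpha> y"
  using assms(1)
proof (rule DERIV_pos_imp_increasing_open)
  fix z assume "x < z" "z < y"
  then show "\<exists>d. (std_bn \<alpha> has_field_derivative d) (at z) \<and> 0 < d"
    using has_field_derivative_std_bn std_bn_pos assms(2) by (blast intro: mult_pos_pos)
qed (rule continuous_on_std_bn)

lemma std_bn_strict_antimono_on: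
  assumes "x < y" "\<And>z. x < z \<Longrightarrow> z < y \<Longrightarrow> log_slope \<alpha> z < 0"
  shows "std_bn \<alpha> y < std_bn \<alpha> x"
  using assms(1)
proof (rule DERIV_neg_imp_decreasing_open)
  fix z assume "x < z" "z < y"
  then show "\<exists>d. (std_bn \<alpha> has_field_derivative d) (at z) \<and> d < 0"
    using has_field_derivative_std_bn std_bn_pos assms(2) by (blast intro: mult_pos_neg)
qed (rule continuous_on_std_bn)

section \<open>Modes as critical points\<close>

lemma is_mode_iff_metric:
  "is_mode f x \<longleftrightarrow> (\<exists>d>0. \<forall>y. \<bar>y - x\<bar> < d \<longrightarrow> f y \<le> f x)"
  by (simp add: is_mode_def eventually_nhds_metric dist_real_def)

lemma is_mode_std_bn_imp_critical:
  assumes "is_mode (std_bn \<alpha>) z"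
  shows "log_slope \<alpha> z = 0"
proof -
  obtain d where "0 < d" "\<And>y. \<bar>y - z\<bar> < d \<Longrightarrow> std_bn \<alpha> y \<le> std_bn \<alpha> z"
    using assms unfolding is_mode_iff_metric by blast
  then have "std_bn \<alpha> z * log_slope \<alpha> z = 0"
    by (intro DERIV_local_max[OF has_field_derivative_std_bn]) (auto simp: abs_minus_commute)
  then show ?thesis using std_bn_pos[of \<alpha> z] by simp
qed

lemma is_mode_std_bn_minus: "is_mode (std_bn \<alpha>) (- z) \<longleftrightarrow> is_mode (std_bn \<alpha>) z"
proof -
  have "is_mode (std_bn \<alpha>) (- z)" if "is_mode (std_bn \<alpha>) z" for z
  proof -
    obtain d where d: "0 < d" "\<And>y. \<bar>y - z\<bar> < d \<Longrightarrow> std_bn \<alpha> y \<le> std_bn \<alpha> z"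
      using \<open>is_mode (std_bn \<alpha>) z\<close> unfolding is_mode_iff_metric by blast
    have "std_bn \<alpha> y \<le> std_bn \<alpha> (- z)" if "\<bar>y - - z\<bar> < d" for y
      using d(2)[of "- y"] that by simp
    then show ?thesis using d(1) unfolding is_mode_iff_metric by blast
  qed
  from this[of z] this[of "- z"] show ?thesis by auto
qed

section \<open>The modes of the standardized density\<close>

lemma modes_std_bn_unimodal:
  assumes "0 \<le> \<alpha>" "\<alpha> \<le> 1"
  shows "{z. is_mode (std_bn \<alpha>) z} = {0}"
proof -
  have neg: "log_slope \<alpha> z < 0" if "0 < z" for z
  \<comment> \<open>Multiplying a strict inequality by \<alpha> needs \<alpha> > 0; for \<alpha> = 0
    the expression is just \<open>- z\<close>.\<close>
  proof (cases "\<alpha> = 0")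
    case False
    then have "\<alpha> * tanh (\<alpha> * z) < \<alpha> * (\<alpha> * z)"
      using assms that by (intro mult_strict_left_mono tanh_less_self) auto
    also have "\<dots> \<le> 1 * (1 * z)"
      using assms that by (intro mult_mono) auto
    finally show ?thesis by (simp add: log_slope_def)
  qed (use that in \<open>simp add: log_slope_def\<close>)
  have le: "std_bn \<alpha> z \<le> std_bn \<alpha> 0" if "0 \<le> z" for z
    using std_bn_strict_antimono_on[of 0 z \<alpha>] neg that by (cases "z = 0") (auto simp: less_imp_le)
  have "std_bn \<alpha> z \<le> std_bn \<alpha> 0" for z
    using le[of z] le[of "- z"] by (cases "0 \<le> z") auto
  then have "is_mode (std_bn \<alpha>) 0"
    by (simp add: is_mode_def)
  moreover have "z = 0" if "is_mode (std_bn \<alpha>) z" for z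
  proof (rule ccontr)
    assume "z \<noteq> 0"
    then show False
      using is_mode_std_bn_imp_critical[OF that] neg[of z] neg[of "- z"]
      by (cases "0 < z") auto
  qed
  ultimately show ?thesis by auto
qed

text \<open>Existence of \<open>c\<close> comes from the intermediate value theorem, the signs on
  either side of it from the decreasing chord slopes of \<open>tanh\<close>.\<close>

lemma log_slope_pos_root:
  assumes "1 < \<alpha>"
  obtains c where "0 < c" "log_slope \<alpha> c = 0"
    "\<And>z. 0 < z \<Longrightarrow> z < c \<Longrightarrow> 0 < log_slope \<alpha> z"
    "\<And>z. c < z \<Longrightarrow> log_slope \<alpha> z < 0"
proof -
  have deriv: "(log_slope \<alpha> has_field_derivative (\<alpha>\<^sup>2 * (1 - (tanh (\<alpha> * z))\<^sup>2) - 1)) (at z)" for z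
    unfolding log_slope_def [abs_def]
    by (auto intro!: derivative_eq_intros simp: power2_eq_square)
  \<comment> \<open>The derivative of \<open>log_slope \<alpha>\<close> at 0 is
    \<open>\<alpha>\<^sup>2 - 1 > 0\<close>, so the function is positive just to the right of its
    zero at 0.\<close>
  have "1 < \<alpha>\<^sup>2" using assms by (simp add: one_less_power)
  then obtain d where d: "0 < d" "\<And>h. 0 < h \<Longrightarrow> h < d \<Longrightarrow> log_slope \<alpha> 0 < log_slope \<alpha> (0 + h)"
    using DERIV_pos_inc_right[OF deriv[of 0]] by auto
  \<comment> \<open>A left endpoint with positive value, kept below \<alpha>, where
    \<open>tanh < 1\<close> makes the value negative.\<close>
  define b where "b = min (d / 2) (\<alpha> / 2)"
  have b: "0 < b" "b < d" "b < \<alpha>"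
    using d(1) assms by (auto simp: b_def)
  have "0 < log_slope \<alpha> b"
    using d(2)[of b] b by (simp add: log_slope_def)
  moreover have "log_slope \<alpha> \<alpha> < 0"
    using tanh_real_lt_1[of "\<alpha> * \<alpha>"] assms by (simp add: log_slope_def)
  moreover have "continuous_on {b..\<alpha>} (log_slope \<alpha>)"
    by (rule DERIV_continuous_on, rule DERIV_subset[OF deriv]) simp
  ultimately obtain c where c: "b \<le> c" "log_slope \<alpha> c = 0"
    using IVT2'[of "log_slope \<alpha>" \<alpha> 0 b] b by auto
  have "0 < c" using b c by simp
  \<comment> \<open>Turns the chord comparison at \<open>\<alpha> * z\<close> and
    \<open>\<alpha> * c\<close> into one between \<open>z\<close> and
    \<open>\<alpha> * tanh (\<alpha> * z)\<close>, up to the factor \<open>c\<close>.\<close>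
  have root: "\<alpha> * z * tanh (\<alpha> * c) = z * c" for z
  proof -
    have "\<alpha> * z * tanh (\<alpha> * c) = z * (\<alpha> * tanh (\<alpha> * c))" by simp
    also have "\<alpha> * tanh (\<alpha> * c) = c" using c(2) by (simp add: log_slope_def)
    finally show ?thesis .
  qed
  show thesis
  proof (rule that[OF \<open>0 < c\<close> c(2)])
    fix z assume z: "0 < z" "z < c"
    have "\<alpha> * z * tanh (\<alpha> * c) < \<alpha> * c * tanh (\<alpha> * z)"
      using z assms by (intro tanh_chord_slope_less) auto
    then have "c * z < c * (\<alpha> * tanh (\<alpha> * z))"
      unfolding root by (simp add: mult_ac)
    then show "0 < log_slope \<alpha> z"
      using \<open>0 < c\<close> by (simp add: log_slope_def)
  next
    fix z assume z: "c < z"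
    have "\<alpha> * c * tanh (\<alpha> * z) < \<alpha> * z * tanh (\<alpha> * c)"
      using z assms \<open>0 < c\<close> by (intro tanh_chord_slope_less) auto
    then have "c * (\<alpha> * tanh (\<alpha> * z)) < c * z"
      unfolding root by (simp add: mult_ac)
    then show "log_slope \<alpha> z < 0"
      using \<open>0 < c\<close> by (simp add: log_slope_def)
  qed
qed

lemma modes_std_bn_bimodal:
  assumes "1 < \<alpha>"
  obtains c where "0 < c" "{z. is_mode (std_bn \<alpha>) z} = {c, - c}"
proof -
  obtain c where c: "0 < c" "log_slope \<alpha> c = 0"
    and pos: "\<And>z. 0 < z \<Longrightarrow> z < c \<Longrightarrow> 0 < log_slope \<alpha> z"
    and neg: "\<And>z. c < z \<Longrightarrow> log_slope \<alpha> z < 0"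
    using log_slope_pos_root[OF assms] by blast
  \<comment> \<open>Radius \<open>c\<close> keeps the neighbourhood inside the positive axis, where
    the signs are known.\<close>
  have "std_bn \<alpha> y \<le> std_bn \<alpha> c" if y: "\<bar>y - c\<bar> < c" for y
  proof -
    consider "0 < y" "y < c" | "y = c" | "c < y"
      using y by linarith
    then show ?thesis
      using std_bn_strict_mono_on[of y c \<alpha>] std_bn_strict_antimono_on[of c y \<alpha>] pos neg
      by cases (auto simp: less_imp_le)
  qed
  then have mode: "is_mode (std_bn \<alpha>) c"
    using c(1) unfolding is_mode_iff_metric by blast
  \<comment> \<open>The origin is critical too, but the density increases strictly from 0 to
    \<open>c\<close>.\<close>
  have "\<not> is_mode (std_bn \<alpha>) 0"
  proof
    assume "is_mode (std_bn \<alpha>) 0"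
    then obtain d where d: "0 < d" "\<And>y. \<bar>y\<bar> < d \<Longrightarrow> std_bn \<alpha> y \<le> std_bn \<alpha> 0"
      unfolding is_mode_iff_metric by auto
    define y where "y = min (d / 2) c"
    have "0 < y" "y < d" "y \<le> c" using d(1) c(1) by (auto simp: y_def)
    then show False
      using d(2)[of y] std_bn_strict_mono_on[of 0 y \<alpha>] pos by force
  qed
  moreover have "z = c" if "log_slope \<alpha> z = 0" "0 < z" for z
    using pos[of z] neg[of z] that by (cases z c rule: linorder_cases) auto
  \<comment> \<open>Negative roots are reflected to positive ones, \<open>log_slope \<alpha>\<close>
    being odd.\<close>
  then have "z = c \<or> z = - c \<or> z = 0" if "log_slope \<alpha> z = 0" for z
    using that by (metis log_slope_minus minus_equation_iff neg_0_equal_iff_equal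
        neg_0_less_iff_less linorder_neqE_linordered_idom)
  ultimately have "{z. is_mode (std_bn \<alpha>) z} = {c, - c}"
    using mode is_mode_std_bn_minus[of \<alpha> c] is_mode_std_bn_imp_critical by blast
  then show thesis using that c(1) by blast
qed

section \<open>Invariance under change of location, scale and height\<close>

lemma is_mode_affine:
  fixes f g :: "real \<Rightarrow> real"
  assumes "0 < \<sigma>" "0 < K" "\<And>x. f x = K * g ((x - \<mu>) / \<sigma>)"
  shows "is_mode f (\<mu> + \<sigma> * z) \<longleftrightarrow> is_mode g z"
proof -
  have "filterlim (\<lambda>z. \<mu> + \<sigma> * z) (nhds (\<mu> + \<sigma> * z)) (nhds z)"
    by (intro tendsto_intros filterlim_ident)
  moreover have "filterlim (\<lambda>x. (x - \<mu>) / \<sigma>) (nhds ((\<mu> + \<sigma> * z - \<mu>) / \<sigma>)) (nhds (\<mu> + \<sigma> * z))"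
    using assms(1) by (intro tendsto_intros filterlim_ident) auto
  ultimately have lim: "filterlim (\<lambda>z. \<mu> + \<sigma> * z) (nhds (\<mu> + \<sigma> * z)) (nhds z)"
      "filterlim (\<lambda>x. (x - \<mu>) / \<sigma>) (nhds z) (nhds (\<mu> + \<sigma> * z))"
    using assms(1) by simp_all
  have eq: "f y \<le> f (\<mu> + \<sigma> * z) \<longleftrightarrow> g ((y - \<mu>) / \<sigma>) \<le> g z" for y
    using assms by simp
  \<comment> \<open>Each direction pulls a neighbourhood back along one of the two mutually inverse
    continuous maps.\<close>
  show ?thesis
    unfolding is_mode_def eq
    using eventually_compose_filterlim[OF _ lim(1), of "\<lambda>y. g ((y - \<mu>) / \<sigma>) \<le> g z"]
      eventually_compose_filterlim[OF _ lim(2), of "\<lambda>y. g y \<le> g z"] assms(1) by auto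
qed

lemma card_modes_affine:
  fixes f g :: "real \<Rightarrow> real"
  assumes "0 < \<sigma>" "0 < K" "\<And>x. f x = K * g ((x - \<mu>) / \<sigma>)"
  shows "card {x. is_mode f x} = card {z. is_mode g z}"
proof (rule sym, rule bij_betw_same_card, rule bij_betw_byWitness)
  show "\<forall>z\<in>{z. is_mode g z}. (\<mu> + \<sigma> * z - \<mu>) / \<sigma> = z"
    and "\<forall>x\<in>{x. is_mode f x}. \<mu> + \<sigma> * ((x - \<mu>) / \<sigma>) = x"
    using assms(1) by auto
  show "(\<lambda>z. \<mu> + \<sigma> * z) ` {z. is_mode g z} \<subseteq> {x. is_mode f x}"
    using is_mode_affine[of \<sigma> K f g \<mu>, OF assms] by auto
  show "(\<lambda>x. (x - \<mu>) / \<sigma>) ` {x. is_mode f x} \<subseteq> {z. is_mode g z}"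
  proof clarify
    fix x assume "is_mode f x"
    then show "is_mode g ((x - \<mu>) / \<sigma>)"
      using is_mode_affine[of \<sigma> K f g \<mu> "(x - \<mu>) / \<sigma>", OF assms] assms(1) by simp
  qed
qed

theorem theorem3p1:
  fixes \<mu> \<sigma> \<alpha> :: real
  assumes "\<sigma> > 0"
  shows "(\<bar>\<alpha>\<bar> \<le> 1 \<longrightarrow> unimodal (bn_density \<mu> \<sigma> \<alpha>)) \<and>
         (\<bar>\<alpha>\<bar> > 1 \<longrightarrow> bimodal (bn_density \<mu> \<sigma> \<alpha>))"
proof -
  \<comment> \<open>All factors of the density that do not depend on \<open>x\<close>.\<close>
  define K where "K = 1 / sqrt (2 * pi * \<sigma>\<^sup>2) * exp (- \<alpha>\<^sup>2 / 2)"
  have "0 < K" using assms by (simp add: K_def)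
  moreover have "exp (- (1 / 2) * u\<^sup>2 - \<alpha>\<^sup>2 / 2) = exp (- \<alpha>\<^sup>2 / 2) * exp (- u\<^sup>2 / 2)" for u
    by (simp flip: exp_add)
  then have "bn_density \<mu> \<sigma> \<alpha> x = K * std_bn \<bar>\<alpha>\<bar> ((x - \<mu>) / \<sigma>)" for x
    unfolding std_bn_abs
    by (simp only: bn_density_def K_def std_bn_def mult.assoc)
  ultimately have card: "card {x. is_mode (bn_density \<mu> \<sigma> \<alpha>) x} = card {z. is_mode (std_bn \<bar>\<alpha>\<bar>) z}"
    using card_modes_affine[OF assms] by blast
  show ?thesis
  proof (intro conjI impI)
    assume "\<bar>\<alpha>\<bar> \<le> 1"
    then show "unimodal (bn_density \<mu> \<sigma> \<alpha>)"
      by (simp add: unimodal_def card modes_std_bn_unimodal)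
  next
    assume "\<bar>\<alpha>\<bar> > 1"
    then obtain c where "0 < c" "{z. is_mode (std_bn \<bar>\<alpha>\<bar>) z} = {c, - c}"
      by (rule modes_std_bn_bimodal)
    \<comment> \<open>Positivity of \<open>c\<close> makes the two modes distinct.\<close>
    then show "bimodal (bn_density \<mu> \<sigma> \<alpha>)"
      by (simp add: bimodal_def card)
  qed
qed

end
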